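(* Let $(\varPhi,\overline{y})$ be a relatively normalized skew ruled surface in $\mathbb{E}^3$ with distribution parameter $\delta$, conical curvature $\kappa$ and support function $q$. Then the divergence $\operatorname{div}^G\overline{T}$ of the Tchebychev vector field with respect to the relative metric $G$ and the scalar curvature $S$ of $G$ satisfy $$\operatorname{div}^G\overline{T}-2S=\frac{2\,\kappa\,w\,q}{\delta^2}.$$
   Context: Ruled surface: $\varPhi$ is a $C^r$ ruled surface ($r\ge3$) of nowhere vanishing Gaussian curvature in $\mathbb{E}^3$, parametrized by $\overline{x}(u,v)=\overline{s}(u)+v\,\overline{e}(u)$ on $U=I\times\mathbb{R}$ ($I$ an open interval), with $|\overline{e}|=|\overline{e}'|=1$, $\langle\overline{s}',\overline{e}'\rangle=0$ (prime $=d/du$). Put $\overline{n}=\overline{e}'$, $\overline{z}=\overline{e}\times\overline{n}$, $\delta=(\overline{s}',\overline{e},\overline{e}')$ (nowhere zero), $\kappa=(\overline{e},\overline{e}',\overline{e}'')$, and let $\lambda=\lambda(u)$ be defined by $\overline{s}'=\delta\lambda\,\overline{e}+\delta\,\overline{z}$. Put $w=\sqrt{\delta^2+v^2}$; the unit normal is $\overline{\xi}=(\delta\overline{n}-v\overline{z})/w$; $h_{ij}$ are the coefficients of the second fundamental form with respect to $\overline{\xi}$: $h_{11}=-(\kappa w^2+\delta'v-\delta^2\lambda)/w$, $h_{12}=\delta/w$, $h_{22}=0$. Write $u^1=u,u^2=v$, $f_{/i}=\partial f/\partial u^i$. All functions are differentiable as often as required. Relative normalization: a map $\overline{y}$ on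 $U$ with $\overline{x}_{/1},\overline{x}_{/2},\overline{y}$ linearly independent and $\overline{y}_{/1},\overline{y}_{/2}$ in the span of $\overline{x}_{/1},\overline{x}_{/2}$. Support function: $q=\langle\overline{\xi},\overline{y}\rangle$ (nowhere zero). Relative metric: $G_{ij}=h_{ij}/q$ (indefinite), inverse $G^{(ij)}$, covariant derivative $\nabla^G$. Darboux tensor: $A_{ijk}=\frac1q\langle\overline{\xi},\nabla^G_k\nabla^G_j\overline{x}_{/i}\rangle$. Tchebychev vector: $\overline{T}=T^m\overline{x}_{/m}$, $T^m=\frac12A_i^{\,im}=\frac12G^{(ij)}G^{(km)}A_{ijk}$. Divergence: $\operatorname{div}^G\overline{T}=|G|^{-1/2}(|G|^{1/2}T^i)_{/i}$ with $G=\det(G_{ij})$. $S$ is the curvature of the pseudo-Riemannian surface with metric $G_{ij}$, normalized as Gaussian curvature, $S=R_{1212}/\det(G_{ij})$ (positive for round spheres in the Riemannian case). *)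

theory Defs
  imports "HOL-Analysis.Analysis"
begin

section \<open>Derivatives of curves and of maps of the parameters \<open>(u, v)\<close>\<close>

definition cderiv :: "(real \<Rightarrow> 'a::real_normed_vector) \<Rightarrow> real \<Rightarrow> 'a" where
  "cderiv f t = vector_derivative f (at t)"

text \<open>Class \<open>C\<^sup>r\<close> on \<open>I\<close>; only used for open \<open>I\<close>, so that \<open>at t\<close> needs no restriction to \<open>I\<close>.\<close>

definition Cr_on :: "nat \<Rightarrow> real set \<Rightarrow> (real \<Rightarrow> 'a::real_normed_vector) \<Rightarrow> bool" where
  "Cr_on r I f \<longleftrightarrow>
     (\<forall>k<r. \<forall>t\<in>I. (cderiv ^^ k) f differentiable (at t)) \<and>
     continuous_on I ((cderiv ^^ r) f)"

text \<open>Indices range over the type \<open>2\<close> (elements \<open>1\<close> and \<open>2\<close>, with \<open>2 = 0\<close>);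
  \<open>u\<^sup>1 = u\<close> and \<open>u\<^sup>2 = v\<close>.\<close>

definition along :: "2 \<Rightarrow> (real \<Rightarrow> real \<Rightarrow> 'a) \<Rightarrow> real \<Rightarrow> real \<Rightarrow> real \<Rightarrow> 'a" where
  "along i f u v = (if i = 1 then (\<lambda>t. f t v) else (\<lambda>t. f u t))"

definition pd :: "2 \<Rightarrow> (real \<Rightarrow> real \<Rightarrow> 'a::real_normed_vector) \<Rightarrow> real \<Rightarrow> real \<Rightarrow> 'a" where
  "pd i f u v = cderiv (along i f u v) (if i = 1 then u else v)"

definition C1_on_strip :: "real set \<Rightarrow> (real \<Rightarrow> real \<Rightarrow> 'a::real_normed_vector) \<Rightarrow> bool" where
  "C1_on_strip I f \<longleftrightarrow>
     (\<forall>i. \<forall>u\<in>I. \<forall>v. along i f u v differentiable (at (if i = 1 then u else v))) \<and>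
     (\<forall>i. continuous_on (I \<times> UNIV) (\<lambda>(u, v). pd i f u v))"

section \<open>Geometry of a metric on the parameter domain\<close>

type_synonym metric2 = "real \<Rightarrow> real \<Rightarrow> real^2^2"

definition ginv :: "metric2 \<Rightarrow> 2 \<Rightarrow> 2 \<Rightarrow> real \<Rightarrow> real \<Rightarrow> real" where
  "ginv G i j u v = matrix_inv (G u v) $ i $ j"

text \<open>\<open>christoffel G m i j\<close> is \<open>\<Gamma>\<^sup>m\<^sub>i\<^sub>j\<close>.\<close>

definition christoffel :: "metric2 \<Rightarrow> 2 \<Rightarrow> 2 \<Rightarrow> 2 \<Rightarrow> real \<Rightarrow> real \<Rightarrow> real" where
  "christoffel G m i j u v =
     (\<Sum>l\<in>UNIV. ginv G m l u v *
        (pd i (\<lambda>u v. G u v $ l $ j) u v + pd j (\<lambda>u v. G u v $ l $ i) u v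
          - pd l (\<lambda>u v. G u v $ i $ j) u v)) / 2"

text \<open>Covariant derivatives of covariant tensor fields with values in a vector space:
  \<open>nabla1 G W j i\<close> is \<open>\<nabla>\<^sub>j W\<^sub>i\<close> and \<open>nabla2 G W k i j\<close> is \<open>\<nabla>\<^sub>k W\<^sub>i\<^sub>j\<close>.\<close>

definition nabla1 :: "metric2 \<Rightarrow> (2 \<Rightarrow> real \<Rightarrow> real \<Rightarrow> 'a::real_normed_vector)
    \<Rightarrow> 2 \<Rightarrow> 2 \<Rightarrow> real \<Rightarrow> real \<Rightarrow> 'a" where
  "nabla1 G W j i u v =
     pd j (W i) u v - (\<Sum>m\<in>UNIV. christoffel G m j i u v *\<^sub>R W m u v)"

definition nabla2 :: "metric2 \<Rightarrow> (2 \<Rightarrow> 2 \<Rightarrow> real \<Rightarrow> real \<Rightarrow> 'a::real_normed_vector)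
    \<Rightarrow> 2 \<Rightarrow> 2 \<Rightarrow> 2 \<Rightarrow> real \<Rightarrow> real \<Rightarrow> 'a" where
  "nabla2 G W k i j u v =
     pd k (W i j) u v
       - (\<Sum>m\<in>UNIV. christoffel G m k i u v *\<^sub>R W m j u v)
       - (\<Sum>m\<in>UNIV. christoffel G m k j u v *\<^sub>R W i m u v)"

text \<open>\<open>riemann_up G l k i j\<close> is \<open>R\<^sup>l\<^sub>k\<^sub>i\<^sub>j\<close>, the \<open>l\<close>-th component of
  \<open>\<nabla>\<^sub>i\<nabla>\<^sub>j\<partial>\<^sub>k - \<nabla>\<^sub>j\<nabla>\<^sub>i\<partial>\<^sub>k\<close>; with this sign \<open>R\<^sub>1\<^sub>2\<^sub>1\<^sub>2 / det G\<close> is \<open>1\<close> on the unit sphere.\<close>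

definition riemann_up :: "metric2 \<Rightarrow> 2 \<Rightarrow> 2 \<Rightarrow> 2 \<Rightarrow> 2 \<Rightarrow> real \<Rightarrow> real \<Rightarrow> real" where
  "riemann_up G l k i j u v =
     pd i (christoffel G l j k) u v - pd j (christoffel G l i k) u v
       + (\<Sum>m\<in>UNIV. christoffel G l i m u v * christoffel G m j k u v)
       - (\<Sum>m\<in>UNIV. christoffel G l j m u v * christoffel G m i k u v)"

definition riemann :: "metric2 \<Rightarrow> 2 \<Rightarrow> 2 \<Rightarrow> 2 \<Rightarrow> 2 \<Rightarrow> real \<Rightarrow> real \<Rightarrow> real" where
  "riemann G l k i j u v = (\<Sum>m\<in>UNIV. G u v $ l $ m * riemann_up G m k i j u v)"

definition scalar_curvature :: "metric2 \<Rightarrow> real \<Rightarrow> real \<Rightarrow> real" where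
  "scalar_curvature G u v = riemann G 1 2 1 2 u v / det (G u v)"

definition divergence :: "metric2 \<Rightarrow> (2 \<Rightarrow> real \<Rightarrow> real \<Rightarrow> real) \<Rightarrow> real \<Rightarrow> real \<Rightarrow> real" where
  "divergence G T u v =
     (\<Sum>i\<in>UNIV. pd i (\<lambda>u v. sqrt \<bar>det (G u v)\<bar> * T i u v) u v) / sqrt \<bar>det (G u v)\<bar>"

section \<open>Ruled surfaces\<close>

definition triple :: "real^3 \<Rightarrow> real^3 \<Rightarrow> real^3 \<Rightarrow> real" where
  "triple a b c = a \<bullet> cross3 b c"

definition surf :: "(real \<Rightarrow> real^3) \<Rightarrow> (real \<Rightarrow> real^3) \<Rightarrow> real \<Rightarrow> real \<Rightarrow> real^3" where
  "surf s e u v = s u + v *\<^sub>R e u"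

definition central_normal :: "(real \<Rightarrow> real^3) \<Rightarrow> real \<Rightarrow> real^3" where
  "central_normal e u = cderiv e u"

definition central_tangent :: "(real \<Rightarrow> real^3) \<Rightarrow> real \<Rightarrow> real^3" where
  "central_tangent e u = cross3 (e u) (central_normal e u)"

definition distribution_parameter :: "(real \<Rightarrow> real^3) \<Rightarrow> (real \<Rightarrow> real^3) \<Rightarrow> real \<Rightarrow> real" where
  "distribution_parameter s e u = triple (cderiv s u) (e u) (cderiv e u)"

definition conical_curvature :: "(real \<Rightarrow> real^3) \<Rightarrow> real \<Rightarrow> real" where
  "conical_curvature e u = triple (e u) (cderiv e u) (cderiv (cderiv e) u)"

definition width :: "(real \<Rightarrow> real^3) \<Rightarrow> (real \<Rightarrow> real^3) \<Rightarrow> real \<Rightarrow> real \<Rightarrow> real" where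
  "width s e u v = sqrt ((distribution_parameter s e u)\<^sup>2 + v\<^sup>2)"

definition unit_normal :: "(real \<Rightarrow> real^3) \<Rightarrow> (real \<Rightarrow> real^3) \<Rightarrow> real \<Rightarrow> real \<Rightarrow> real^3" where
  "unit_normal s e u v =
     (distribution_parameter s e u *\<^sub>R central_normal e u - v *\<^sub>R central_tangent e u)
       /\<^sub>R width s e u v"

definition first_ff :: "(real \<Rightarrow> real^3) \<Rightarrow> (real \<Rightarrow> real^3) \<Rightarrow> metric2" where
  "first_ff s e u v = (\<chi> i j. pd i (surf s e) u v \<bullet> pd j (surf s e) u v)"

definition second_ff :: "(real \<Rightarrow> real^3) \<Rightarrow> (real \<Rightarrow> real^3) \<Rightarrow> metric2" where
  "second_ff s e u v = (\<chi> i j. unit_normal s e u v \<bullet> pd j (pd i (surf s e)) u v)"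

definition gaussian_curvature :: "(real \<Rightarrow> real^3) \<Rightarrow> (real \<Rightarrow> real^3) \<Rightarrow> real \<Rightarrow> real \<Rightarrow> real" where
  "gaussian_curvature s e u v = det (second_ff s e u v) / det (first_ff s e u v)"

text \<open>The distribution parameter is nowhere zero exactly when the Gaussian curvature
  \<open>K = - \<delta>\<^sup>2 / w\<^sup>4\<close> is; both are listed. In either case \<open>x\<^sub>/\<^sub>1, x\<^sub>/\<^sub>2\<close> are automatically
  independent, because \<open>x\<^sub>/\<^sub>1 \<times> x\<^sub>/\<^sub>2 = \<delta> n - v z\<close>.\<close>

definition skew_ruled_surface ::
    "nat \<Rightarrow> real set \<Rightarrow> (real \<Rightarrow> real^3) \<Rightarrow> (real \<Rightarrow> real^3) \<Rightarrow> bool" where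
  "skew_ruled_surface r I s e \<longleftrightarrow>
     open I \<and> is_interval I \<and> I \<noteq> {} \<and>
     r \<ge> 3 \<and> Cr_on r I s \<and> Cr_on r I e \<and>
     (\<forall>u\<in>I. norm (e u) = 1 \<and> norm (cderiv e u) = 1 \<and> cderiv s u \<bullet> cderiv e u = 0) \<and>
     (\<forall>u\<in>I. distribution_parameter s e u \<noteq> 0) \<and>
     (\<forall>u\<in>I. \<forall>v. gaussian_curvature s e u v \<noteq> 0)"

section \<open>Relative normalizations\<close>

definition relative_normalization :: "real set \<Rightarrow> (real \<Rightarrow> real^3) \<Rightarrow> (real \<Rightarrow> real^3) \<Rightarrow>
    (real \<Rightarrow> real \<Rightarrow> real^3) \<Rightarrow> bool" where
  "relative_normalization I s e y \<longleftrightarrow>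
     C1_on_strip I y \<and>
     (\<forall>u\<in>I. \<forall>v.
        (\<forall>a b c. a *\<^sub>R pd 1 (surf s e) u v + b *\<^sub>R pd 2 (surf s e) u v + c *\<^sub>R y u v = 0
            \<longrightarrow> a = 0 \<and> b = 0 \<and> c = 0) \<and>
        (\<forall>i. pd i y u v \<in> span {pd 1 (surf s e) u v, pd 2 (surf s e) u v}))"

context
  fixes s e :: "real \<Rightarrow> real^3" and y :: "real \<Rightarrow> real \<Rightarrow> real^3"
begin

definition support_function :: "real \<Rightarrow> real \<Rightarrow> real" where
  "support_function u v = unit_normal s e u v \<bullet> y u v"

definition relative_metric :: metric2 where
  "relative_metric u v = (\<chi> i j. second_ff s e u v $ i $ j / support_function u v)"

text \<open>\<open>darboux i j k\<close> is \<open>A\<^sub>i\<^sub>j\<^sub>k\<close>.\<close>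

definition darboux :: "2 \<Rightarrow> 2 \<Rightarrow> 2 \<Rightarrow> real \<Rightarrow> real \<Rightarrow> real" where
  "darboux i j k u v =
     (unit_normal s e u v \<bullet>
        nabla2 relative_metric
          (\<lambda>i j. nabla1 relative_metric (\<lambda>i. pd i (surf s e)) j i) k i j u v)
       / support_function u v"

text \<open>Components \<open>T\<^sup>m\<close> with respect to the frame \<open>x\<^sub>/\<^sub>1, x\<^sub>/\<^sub>2\<close>.\<close>

definition tchebychev :: "2 \<Rightarrow> real \<Rightarrow> real \<Rightarrow> real" where
  "tchebychev m u v =
     (\<Sum>i\<in>UNIV. \<Sum>j\<in>UNIV. \<Sum>k\<in>UNIV.
        ginv relative_metric i j u v * ginv relative_metric k m u v * darboux i j k u v) / 2"

end

end

theory Submission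
  imports Defs
begin

text \<open>
  Since \<open>h\<^sub>2\<^sub>2 = 0\<close>, the relative metric is governed by \<open>b = G\<^sub>1\<^sub>2\<close> and the quotient
  \<open>p = h\<^sub>1\<^sub>1 / h\<^sub>1\<^sub>2\<close>, which is quadratic in \<open>v\<close> with leading coefficient \<open>- \<kappa> / \<delta>\<close>; the
  normalization enters through \<open>b = \<delta> / Q\<close> with \<open>Q = w q\<close> only. With \<open>\<alpha> = b\<^sub>/\<^sub>1 / b\<close> and
  \<open>\<beta> = b\<^sub>/\<^sub>2 / b\<close> one finds
  \<open>2 S = ((p\<^sub>/\<^sub>2 + p \<beta>)\<^sub>/\<^sub>2 - 2 \<beta>\<^sub>/\<^sub>1) / b\<close>,
  \<open>T\<^sup>1 = - \<beta> / b\<close> and \<open>T\<^sup>2 = (- v \<kappa> / \<delta> - \<alpha> - p\<^sub>/\<^sub>2 / 2 + p \<beta>) / b\<close>. As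
  \<open>\<alpha>\<^sub>/\<^sub>2 = \<beta>\<^sub>/\<^sub>1\<close>, all that survives in \<open>div T - 2 S\<close> is
  \<open>(- \<kappa> / \<delta> - 3 p\<^sub>/\<^sub>2\<^sub>/\<^sub>2 / 2) / b = 2 \<kappa> / (\<delta> b)\<close>.

  The curves are only known to be \<open>C\<^sup>3\<close> and \<open>y\<close> only \<open>C\<^sup>1\<close>. This suffices, because
  \<open>Q\<^sub>/\<^sub>2 = - \<langle>z, y\<rangle>\<close> involves no derivative of \<open>y\<close>, and because \<open>A\<^sub>1\<^sub>1\<^sub>1\<close>, whose
  defining derivatives need not exist, is multiplied by \<open>G\<^sup>(\<^sup>1\<^sup>1\<^sup>) = 0\<close> in \<open>T\<close>.
\<close>

section \<open>Partial derivatives\<close>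

lemma pd_1: "pd 1 f u v = vector_derivative (\<lambda>t. f t v) (at u)"
  by (simp add: pd_def along_def cderiv_def)

lemma pd_2: "pd 2 f u v = vector_derivative (f u) (at v)"
  by (simp add: pd_def along_def cderiv_def)

lemma pd_1_eqI: "((\<lambda>t. f t v) has_vector_derivative D) (at u) \<Longrightarrow> pd 1 f u v = D"
  by (simp add: pd_1 vector_derivative_at)

lemma pd_2_eqI: "(f u has_vector_derivative D) (at v) \<Longrightarrow> pd 2 f u v = D"
  by (simp add: pd_2 vector_derivative_at)

lemma pd_1_cong:
  assumes "open I" "u \<in> I" "\<And>t. t \<in> I \<Longrightarrow> f t v = g t v"
  shows "pd 1 f u v = pd 1 g u v"
  unfolding pd_1
proof (rule vector_derivative_cong_eq)
  show "\<forall>\<^sub>F t in nhds u. t \<in> UNIV \<longrightarrow> f t v = g t v"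
    using assms by (auto simp: eventually_nhds)
qed auto

text \<open>Formulas for tensor components are available only for \<open>u\<close> in
  \<open>I\<close>. Openness of \<open>I\<close> makes this enough for the derivative in
  \<open>u\<close>; in the \<open>v\<close> direction \<open>u\<close> stays fixed.\<close>

lemma pd_cong:
  assumes "open I" "u \<in> I" "\<And>u v. u \<in> I \<Longrightarrow> f u v = g u v"
  shows "pd i f u v = pd i g u v"
proof (cases "i = 1")
  case True
  then show ?thesis using pd_1_cong[OF assms(1,2), of f v g] assms(3) by simp
next
  case False
  then have "i = 2" using exhaust_2 by blast
  moreover have "f u = g u" using assms by auto
  ultimately show ?thesis by (simp add: pd_2)
qed

lemma pd_const [simp]: "pd i (\<lambda>u v. c) u v = 0"
  by (simp add: pd_def along_def cderiv_def)

text \<open>The existence of the second mixed derivative is part of the conclusion.\<close>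

lemma partials_commute:
  fixes f fu fv fvu :: "real \<Rightarrow> real \<Rightarrow> real"
  assumes I: "open I" "is_interval I" "u \<in> I"
    and fu: "\<And>u v. u \<in> I \<Longrightarrow> ((\<lambda>t. f t v) has_vector_derivative fu u v) (at u)"
    and fv: "\<And>u v. u \<in> I \<Longrightarrow> (f u has_vector_derivative fv u v) (at v)"
    and fvu: "\<And>u v. u \<in> I \<Longrightarrow> ((\<lambda>t. fv t v) has_vector_derivative fvu u v) (at u)"
    and cont: "continuous_on (I \<times> UNIV) (\<lambda>(u, v). fvu u v)"
  shows "(fu u has_vector_derivative fvu u v) (at v)"
proof -
  have FTC: "(fv x has_integral f x b - f x a) {a..b}" if "x \<in> I" "a \<le> b" for x a b
    using that by (intro fundamental_theorem_of_calculus has_vector_derivative_at_within[OF fv]) auto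
  \<comment> \<open>any base point below \<open>v\<close> would do\<close>
  define w where "w = v - 1"
  \<comment> \<open>The fundamental theorem of calculus for \<open>fv\<close> along
    \<open>{w..t}\<close> is differentiated in \<open>u\<close>, the integral by Leibniz's rule. The
    resulting formula for \<open>fu u t\<close> can then be differentiated in
    \<open>t\<close>.\<close>
  have eq: "fu u t = fu u w + integral {w..t} (fvu u)" if "w \<le> t" for t
  proof -
    have "((\<lambda>x. integral (cbox w t) (fv x)) has_vector_derivative integral (cbox w t) (fvu u))
        (at u within I)"
    proof (rule leibniz_rule_vector_derivative)
      show "continuous_on (I \<times> cbox w t) (\<lambda>(x, t). fvu x t)"
        by (rule continuous_on_subset[OF cont]) auto
      show "convex I" using I is_interval_convex by blast
    qed (use I FTC that in \<open>auto intro!: has_vector_derivative_at_within[OF fvu]\<close>)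
    then have "((\<lambda>x. integral (cbox w t) (fv x)) has_vector_derivative integral (cbox w t) (fvu u))
        (at u)"
      using I by (simp add: at_within_open[of u I])
    moreover have "((\<lambda>x. f x t - f x w) has_vector_derivative fu u t - fu u w) (at u)"
      using I by (intro derivative_intros fu)
    then have "((\<lambda>x. integral (cbox w t) (fv x)) has_vector_derivative fu u t - fu u w) (at u)"
      by (rule has_vector_derivative_transform_within_open[OF _ I(1,3)])
        (use that in \<open>auto intro!: integral_unique[symmetric] FTC\<close>)
    ultimately show ?thesis
      using vector_derivative_unique_at by fastforce
  qed
  have "continuous_on UNIV (\<lambda>t. (\<lambda>(u, v). fvu u v) (u, t))"
    using I by (intro continuous_on_compose2[OF cont]) (auto intro!: continuous_intros)
  \<comment> \<open>The upper end \<open>v+1\<close> makes \<open>v\<close> an interior point, so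
    that the derivative within the interval is a full derivative.\<close>
  then have "continuous_on {w..v+1} (fvu u)"
    by (auto intro: continuous_on_subset)
  then have "((\<lambda>t. integral {w..t} (fvu u)) has_vector_derivative fvu u v) (at v within {w..v+1})"
    by (rule integral_has_vector_derivative) (auto simp: w_def)
  then have "((\<lambda>t. integral {w..t} (fvu u)) has_vector_derivative fvu u v) (at v)"
    by (simp add: at_within_Icc_at w_def)
  then have "((\<lambda>t. fu u w + integral {w..t} (fvu u)) has_vector_derivative fvu u v) (at v)"
    by (auto intro!: derivative_eq_intros)
  then show ?thesis
  proof (rule has_vector_derivative_transform_within_open[of _ _ _ "{w<..}"])
    show "fu u w + integral {w..t} (fvu u) = fu u t" if "t \<in> {w<..}" for t
      using eq[of t] that by simp
  qed (simp_all add: w_def)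
qed

text \<open>\<open>C1_on_strip\<close> asserts continuity of the partials only. Existence of one
  partial and continuity of the other give total differentiability, hence joint continuity of the
  map itself. This is used for the continuity of \<open>Q21\<close>.\<close>

lemma continuous_on_strip_partials:
  fixes f :: "real \<Rightarrow> real \<Rightarrow> 'a::euclidean_space"
  assumes "open I" "C1_on_strip I f"
  shows "continuous_on (I \<times> UNIV) (\<lambda>(u, v). f u v)"
proof -
  have d: "((\<lambda>t. f t v) has_vector_derivative pd 1 f u v) (at u)"
      "(f u has_vector_derivative pd 2 f u v) (at v)" if "u \<in> I" for u v
    using assms(2) that unfolding C1_on_strip_def pd_1 pd_2
    by (auto simp: along_def forall_2 vector_derivative_works[symmetric])
  have c: "continuous_on (I \<times> UNIV) (\<lambda>(u, v). pd 2 f u v)"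
    using assms(2) unfolding C1_on_strip_def by blast
  show ?thesis
  proof (rule differentiable_imp_continuous_on, clarsimp simp: differentiable_on_def)
    fix u v assume u: "u \<in> I"
    have o: "open (I \<times> (UNIV::real set))" using assms by (simp add: open_Times)
    \<comment> \<open>The \<open>v\<close> partial is packed as a bounded linear map because
      \<open>has_derivative_partialsI\<close> asks for its continuity in operator norm.\<close>
    have "((\<lambda>(x, y). f x y) has_derivative
        (\<lambda>(tx, ty). tx *\<^sub>R pd 1 f u v + blinfun_apply (blinfun_scaleR_left (pd 2 f u v)) ty)) (at (u, v) within I \<times> UNIV)"
    proof (rule has_derivative_partialsI)
      show "((\<lambda>x. f x v) has_derivative (\<lambda>tx. tx *\<^sub>R pd 1 f u v)) (at u within I)"
        using d(1)[OF u, of v] unfolding has_vector_derivative_def by (rule has_derivative_at_withinI)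
      show "(f x has_derivative blinfun_apply (blinfun_scaleR_left (pd 2 f x y))) (at y within UNIV)"
        if "x \<in> I" "y \<in> UNIV" for x y
        using d(2)[OF that(1), of y] unfolding has_vector_derivative_def by simp
      have "continuous_on (I \<times> UNIV) (\<lambda>p. blinfun_scaleR_left ((\<lambda>(u, v). pd 2 f u v) p))"
        by (intro continuous_intros c)
      then show "continuous (at (u, v) within I \<times> UNIV)
          (\<lambda>(x, y). blinfun_scaleR_left (pd 2 f x y))"
        using u unfolding continuous_on_eq_continuous_within by (auto simp: case_prod_unfold)
    qed (use u in auto)
    then show "(\<lambda>(u, v). f u v) differentiable at (u, v) within I \<times> UNIV"
      unfolding differentiable_def by blast
  qed
qed

lemma pd_1_real_eqI: "((\<lambda>t. f t v) has_real_derivative D) (at u) \<Longrightarrow> pd 1 f u v = D"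
  by (simp add: pd_1_eqI has_real_derivative_iff_has_vector_derivative)

lemma pd_2_real_eqI: "(f u has_real_derivative D) (at v) \<Longrightarrow> pd 2 f u v = D"
  by (simp add: pd_2_eqI has_real_derivative_iff_has_vector_derivative)

lemma differentiable_has_real_derivative_cderiv:
  "f differentiable (at t) \<Longrightarrow> (f has_real_derivative cderiv f t) (at t)"
  by (simp add: cderiv_def has_real_derivative_iff_has_vector_derivative
      vector_derivative_works[symmetric])

text \<open>The sign of a continuous function is locally constant where the function does not
  vanish. This handles the root of the determinant, which is the absolute value of \<open>b\<close>,
  whatever the sign of \<open>b\<close>.\<close>

lemma has_real_derivative_sgn_mult:
  fixes f g :: "real \<Rightarrow> real"
  assumes "isCont g t" "g t \<noteq> 0" "(f has_real_derivative D) (at t)"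
  shows "((\<lambda>t. sgn (g t) * f t) has_real_derivative sgn (g t) * D) (at t)"
proof -
  have g: "(g \<longlongrightarrow> g t) (nhds t)"
    using assms(1) by (simp add: isCont_def tendsto_at_iff_tendsto_nhds)
  have "\<forall>\<^sub>F x in nhds t. sgn (g x) = sgn (g t)"
  proof (cases "g t > 0")
    case True
    from order_tendstoD(1)[OF g this] show ?thesis
      by eventually_elim (use True in simp)
  next
    case False
    then have "g t < 0" using assms(2) by simp
    from order_tendstoD(2)[OF g this] show ?thesis
      by eventually_elim (use \<open>g t < 0\<close> in simp)
  qed
  then have "\<forall>\<^sub>F x in nhds t. sgn (g x) * f x = sgn (g t) * f x"
    by eventually_elim simp
  then show ?thesis
    using DERIV_cmult[OF assms(3)] by (subst DERIV_cong_ev[OF refl _ refl])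
qed

section \<open>Metrics with \<open>G\<^sub>2\<^sub>2 = 0\<close>\<close>

lemma matrix_inv_eqI:
  fixes A B :: "'a::semiring_1^'n^'n"
  assumes "A ** B = mat 1" "B ** A = mat 1"
  shows "matrix_inv A = B"
  unfolding matrix_inv_def
proof (rule some_equality)
  fix C assume "A ** C = mat 1 \<and> C ** A = mat 1"
  then have "C = C ** (A ** B)" "C ** A = mat 1" using assms by simp_all
  then show "C = B" by (simp add: matrix_mul_assoc)
qed (use assms in simp)

text \<open>The \<open>v\<close>-lines are null curves of \<open>G\<close>; on a ruled surface these
  are the rulings, which are asymptotic lines. This is what kills \<open>G^(11)\<close> and the
  symbols \<open>\<Gamma>^1_12\<close>, \<open>\<Gamma>^1_21\<close>,
  \<open>\<Gamma>^1_22\<close>.\<close>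

locale null_metric =
  fixes I :: "real set" and G :: metric2
  assumes open_I: "open I"
    and G22 [simp]: "u \<in> I \<Longrightarrow> G u v $ 2 $ 2 = 0"
    and G21: "u \<in> I \<Longrightarrow> G u v $ 2 $ 1 = G u v $ 1 $ 2"
    and G12 [simp]: "u \<in> I \<Longrightarrow> G u v $ 1 $ 2 \<noteq> 0"
begin

abbreviation "a u v \<equiv> G u v $ 1 $ 1"
abbreviation "b u v \<equiv> G u v $ 1 $ 2"

lemma det_G: "u \<in> I \<Longrightarrow> det (G u v) = - (b u v)\<^sup>2"
  by (simp add: det_2 G21 power2_eq_square)

lemma sqrt_det_G: "u \<in> I \<Longrightarrow> sqrt \<bar>det (G u v)\<bar> = \<bar>b u v\<bar>"
  by (simp add: det_G)

lemma ginv_G: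
  assumes u: "u \<in> I"
  shows "ginv G 1 1 u v = 0" "ginv G 1 2 u v = 1 / b u v" "ginv G 2 1 u v = 1 / b u v"
    "ginv G 2 2 u v = - a u v / (b u v)\<^sup>2"
proof -
  define B :: "real^2^2" where
    "B = vector [vector [0, 1 / b u v], vector [1 / b u v, - a u v / (b u v)\<^sup>2]]"
  have "matrix_inv (G u v) = B"
    using u by (intro matrix_inv_eqI)
      (simp_all add: vec_eq_iff forall_2 matrix_matrix_mult_def mat_def sum_2 B_def G21
        field_simps power2_eq_square)
  then show "ginv G 1 1 u v = 0" "ginv G 1 2 u v = 1 / b u v" "ginv G 2 1 u v = 1 / b u v"
    "ginv G 2 2 u v = - a u v / (b u v)\<^sup>2"
    by (simp_all add: ginv_def B_def)
qed

lemma pd_G: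
  assumes u: "u \<in> I"
  shows "pd i (\<lambda>u v. G u v $ 2 $ 2) u v = 0" "pd i (\<lambda>u v. G u v $ 2 $ 1) u v = pd i b u v"
proof -
  show "pd i (\<lambda>u v. G u v $ 2 $ 1) u v = pd i b u v"
    by (rule pd_cong[OF open_I u G21])
  have "pd i (\<lambda>u v. G u v $ 2 $ 2) u v = pd i (\<lambda>u v. 0) u v"
    by (rule pd_cong[OF open_I u G22])
  then show "pd i (\<lambda>u v. G u v $ 2 $ 2) u v = 0" by simp
qed

lemma christoffel_G:
  assumes u: "u \<in> I"
  shows "christoffel G 1 1 1 u v = (pd 1 b u v - pd 2 a u v / 2) / b u v"
    "christoffel G 1 1 2 u v = 0" "christoffel G 1 2 1 u v = 0" "christoffel G 1 2 2 u v = 0"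
    "christoffel G 2 1 2 u v = pd 2 a u v / (2 * b u v)"
    "christoffel G 2 2 1 u v = pd 2 a u v / (2 * b u v)"
    "christoffel G 2 2 2 u v = pd 2 b u v / b u v"
  using u by (simp_all add: christoffel_def sum_2 ginv_G pd_G field_simps)

text \<open>Since \<open>\<Gamma>^1_12 = \<Gamma>^1_22 = 0\<close>, the component
  \<open>R^1_212\<close> vanishes and the quadratic terms of \<open>R^2_212\<close> cancel, leaving
  the derivatives of \<open>\<Gamma>^2_22\<close> and \<open>\<Gamma>^2_12\<close>. The symbol
  \<open>\<Gamma>^2_11\<close> occurs only multiplied by \<open>\<Gamma>^1_22\<close>.\<close>

lemma scalar_curvature_G:
  assumes u: "u \<in> I"
  shows "scalar_curvature G u v =
    (pd 2 (\<lambda>u v. pd 2 a u v / (2 * b u v)) u v - pd 1 (\<lambda>u v. pd 2 b u v / b u v) u v) / b u v"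
proof -
  have "pd 1 (christoffel G 1 2 2) u v = pd 1 (\<lambda>u v. 0) u v"
    "pd 2 (christoffel G 1 1 2) u v = pd 2 (\<lambda>u v. 0) u v"
    "pd 2 (christoffel G 2 1 2) u v = pd 2 (\<lambda>u v. pd 2 a u v / (2 * b u v)) u v"
    "pd 1 (christoffel G 2 2 2) u v = pd 1 (\<lambda>u v. pd 2 b u v / b u v) u v"
    by (rule pd_cong[OF open_I u], simp add: christoffel_G)+
  then show ?thesis
    using u by (simp add: scalar_curvature_def riemann_def riemann_up_def sum_2 christoffel_G det_G
        power2_eq_square field_simps)
qed

end

section \<open>Relatively normalized ruled surfaces\<close>

lemma Cr_on_has_vector_derivative:
  assumes "Cr_on r I f" "k < r" "t \<in> I"
  shows "((cderiv ^^ k) f has_vector_derivative (cderiv ^^ Suc k) f t) (at t)"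
  using assms by (simp add: Cr_on_def cderiv_def vector_derivative_works[symmetric])

lemma has_vector_derivative_cross3:
  assumes "(f has_vector_derivative f') (at t within S)" "(g has_vector_derivative g') (at t within S)"
  shows "((\<lambda>t. cross3 (f t) (g t)) has_vector_derivative cross3 (f t) g' + cross3 f' (g t))
    (at t within S)"
  using bounded_bilinear.has_vector_derivative[OF _ assms]
    bilinear_conv_bounded_bilinear[of cross3] bilinear_cross by blast

lemma has_vector_derivative_inner:
  assumes "(f has_vector_derivative f') (at t within S)" "(g has_vector_derivative g') (at t within S)"
  shows "((\<lambda>t. f t \<bullet> g t) has_vector_derivative f t \<bullet> g' + f' \<bullet> g t) (at t within S)"
  by (rule bounded_bilinear.has_vector_derivative[OF bounded_bilinear_inner assms])

lemma has_vector_derivative_eq_0_if_constant: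
  assumes "open I" "t \<in> I" "\<And>t. t \<in> I \<Longrightarrow> f t = c" "(f has_vector_derivative D) (at t)"
  shows "D = 0"
proof -
  have "((\<lambda>t. c) has_vector_derivative D) (at t)"
    using has_vector_derivative_transform_within_open[OF assms(4,1,2)] assms(3) by simp
  then show ?thesis
    using vector_derivative_unique_at has_vector_derivative_const by blast
qed

lemma orthonormal_cross_expansion:
  fixes e n a :: "real^3"
  assumes "e \<bullet> e = 1" "n \<bullet> n = 1" "e \<bullet> n = 0"
  shows "a = (a \<bullet> e) *\<^sub>R e + (a \<bullet> n) *\<^sub>R n + (a \<bullet> cross3 e n) *\<^sub>R cross3 e n"
proof -
  define z where "z = cross3 e n"
  have z: "z \<bullet> e = 0" "z \<bullet> n = 0" by (simp_all add: z_def dot_cross_self)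
  have "(norm z)\<^sup>2 = 1"
    using norm_cross_dot[of e n] assms by (simp add: z_def norm_eq_sqrt_inner)
  then have zz: "z \<bullet> z = 1" by (simp add: power2_norm_eq_inner)
  \<comment> \<open>The remainder \<open>r\<close> is orthogonal to the frame. Expanding the double
    cross product shows that \<open>r\<close> is also parallel to \<open>z\<close>, so Lagrange's
    identity forces \<open>r = 0\<close>.\<close>
  define r where "r = a - ((a \<bullet> e) *\<^sub>R e + (a \<bullet> n) *\<^sub>R n + (a \<bullet> z) *\<^sub>R z)"
  have r: "r \<bullet> e = 0" "r \<bullet> n = 0" "r \<bullet> z = 0"
    using assms z zz by (simp_all add: r_def inner_simps inner_commute)
  have "cross3 r z = (r \<bullet> n) *\<^sub>R e - (r \<bullet> e) *\<^sub>R n"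
    unfolding z_def by (simp add: cross3_simps forall_3)
  then have "cross3 r z = 0" using r by simp
  then have "(norm r * norm z)\<^sup>2 = 0"
    using norm_cross_dot[of r z] r by simp
  then have "r = 0" using zz by auto
  then show ?thesis unfolding r_def z_def by simp
qed

locale relatively_normalized_ruled_surface =
  fixes r :: nat and I :: "real set" and s e :: "real \<Rightarrow> real^3" and y :: "real \<Rightarrow> real \<Rightarrow> real^3"
  assumes surface: "skew_ruled_surface r I s e"
    and normalization: "relative_normalization I s e y"
begin

abbreviation n :: "real \<Rightarrow> real^3" where "n \<equiv> cderiv e"
abbreviation z :: "real \<Rightarrow> real^3" where "z \<equiv> central_tangent e"
abbreviation x :: "real \<Rightarrow> real \<Rightarrow> real^3" where "x \<equiv> surf s e"
abbreviation \<delta> :: "real \<Rightarrow> real" where "\<delta> \<equiv> distribution_parameter s e"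
abbreviation \<kappa> :: "real \<Rightarrow> real" where "\<kappa> \<equiv> conical_curvature e"
abbreviation w :: "real \<Rightarrow> real \<Rightarrow> real" where "w \<equiv> width s e"

section \<open>The moving frame, the normal field \<open>m\<close> and the relative metric\<close>

lemma open_I: "open I" and interval_I: "is_interval I" and r_ge_3: "r \<ge> 3"
  using surface by (auto simp: skew_ruled_surface_def)

lemma derivs:
  assumes "u \<in> I"
  shows "(e has_vector_derivative n u) (at u)"
    "(n has_vector_derivative cderiv n u) (at u)"
    "(cderiv n has_vector_derivative cderiv (cderiv n) u) (at u)"
    "(s has_vector_derivative cderiv s u) (at u)"
    "(cderiv s has_vector_derivative cderiv (cderiv s) u) (at u)"
    "(cderiv (cderiv s) has_vector_derivative cderiv (cderiv (cderiv s)) u) (at u)"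
proof -
  have "Cr_on r I s" "Cr_on r I e" using surface by (auto simp: skew_ruled_surface_def)
  note d = this[THEN Cr_on_has_vector_derivative, OF _ assms]
  show "(e has_vector_derivative n u) (at u)"
    "(n has_vector_derivative cderiv n u) (at u)"
    "(cderiv n has_vector_derivative cderiv (cderiv n) u) (at u)"
    "(s has_vector_derivative cderiv s u) (at u)"
    "(cderiv s has_vector_derivative cderiv (cderiv s) u) (at u)"
    "(cderiv (cderiv s) has_vector_derivative cderiv (cderiv (cderiv s)) u) (at u)"
    using d(2)[of 0] d(2)[of 1] d(2)[of 2] d(1)[of 0] d(1)[of 1] d(1)[of 2] r_ge_3
    by (simp_all add: eval_nat_numeral)
qed

lemma y_derivs:
  assumes "u \<in> I"
  shows "((\<lambda>t. y t v) has_vector_derivative pd 1 y u v) (at u)"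
    "(y u has_vector_derivative pd 2 y u v) (at v)"
  using normalization assms
  by (auto simp: relative_normalization_def C1_on_strip_def along_def pd_1 pd_2 forall_2
      vector_derivative_works[symmetric])

lemma frame:
  assumes u: "u \<in> I"
  shows "e u \<bullet> e u = 1" "n u \<bullet> n u = 1" "e u \<bullet> n u = 0" "n u \<bullet> cderiv n u = 0"
    "cderiv s u \<bullet> n u = 0" "\<delta> u \<noteq> 0" "cderiv s u \<bullet> z u = \<delta> u"
proof -
  have *: "e u \<bullet> e u = 1" "n u \<bullet> n u = 1" if "u \<in> I" for u
    using surface that by (simp_all add: skew_ruled_surface_def norm_eq_sqrt_inner)
  from *[OF u] show "e u \<bullet> e u = 1" "n u \<bullet> n u = 1" .
  have "e u \<bullet> n u + n u \<bullet> e u = 0"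
    by (rule has_vector_derivative_eq_0_if_constant[OF open_I u *(1)])
      (auto intro!: has_vector_derivative_inner derivs u)
  then show "e u \<bullet> n u = 0" by (simp add: inner_commute)
  have "n u \<bullet> cderiv n u + cderiv n u \<bullet> n u = 0"
    by (rule has_vector_derivative_eq_0_if_constant[OF open_I u *(2)])
      (auto intro!: has_vector_derivative_inner derivs u)
  then show "n u \<bullet> cderiv n u = 0" by (simp add: inner_commute)
  show "cderiv s u \<bullet> n u = 0" "\<delta> u \<noteq> 0"
    using surface u by (simp_all add: skew_ruled_surface_def)
  show "cderiv s u \<bullet> z u = \<delta> u"
    by (simp add: distribution_parameter_def triple_def central_tangent_def central_normal_def)
qed

lemma z_simps:
  assumes u: "u \<in> I"
  shows "z u \<bullet> e u = 0" "z u \<bullet> n u = 0" "e u \<bullet> z u = 0" "n u \<bullet> z u = 0" "z u \<bullet> z u = 1"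
    "z u \<bullet> cderiv n u = \<kappa> u"
proof -
  show "z u \<bullet> e u = 0" "z u \<bullet> n u = 0" "e u \<bullet> z u = 0" "n u \<bullet> z u = 0"
    by (simp_all add: central_tangent_def central_normal_def dot_cross_self)
  have "(norm (z u))\<^sup>2 = 1"
    using norm_cross_dot[of "e u" "n u"] frame[OF u]
    by (simp add: central_tangent_def central_normal_def norm_eq_sqrt_inner)
  then show "z u \<bullet> z u = 1" by (simp add: power2_norm_eq_inner)
  show "z u \<bullet> cderiv n u = \<kappa> u"
    by (simp add: central_tangent_def central_normal_def conical_curvature_def triple_def cross3_simps)
qed

text \<open>\<open>m = x\<^sub>/\<^sub>1 \<times> x\<^sub>/\<^sub>2\<close>, \<open>Q = w q\<close> and \<open>p = h\<^sub>1\<^sub>1 / h\<^sub>1\<^sub>2\<close>.\<close>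

definition m :: "real \<Rightarrow> real \<Rightarrow> real^3" where
  "m u v = \<delta> u *\<^sub>R n u - v *\<^sub>R z u"

definition Q :: "real \<Rightarrow> real \<Rightarrow> real" where
  "Q u v = m u v \<bullet> y u v"

definition p :: "real \<Rightarrow> real \<Rightarrow> real" where
  "p u v = n u \<bullet> cderiv (cderiv s) u - v * (z u \<bullet> cderiv (cderiv s) u) / \<delta> u - v\<^sup>2 * \<kappa> u / \<delta> u"

text \<open>Because \<open>m\<close> is \<open>w\<close> times the unit normal, these products carry
  the second fundamental form: \<open>m u v \<bullet> n u\<close> is \<open>w h_12\<close> and the
  last line is \<open>w h_11\<close>.\<close>

lemma m_simps:
  assumes u: "u \<in> I"
  shows "m u v \<bullet> e u = 0" "m u v \<bullet> n u = \<delta> u" "m u v \<bullet> cderiv s u = - v * \<delta> u"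
    "m u v \<bullet> cderiv n u = - v * \<kappa> u"
    "m u v \<bullet> (cderiv (cderiv s) u + v *\<^sub>R cderiv n u) = \<delta> u * p u v"
  using frame[OF u] z_simps[OF u]
  by (simp_all add: m_def p_def inner_simps inner_commute field_simps power2_eq_square)

lemma w_pos: "u \<in> I \<Longrightarrow> w u v > 0"
  using frame(6)[of u] by (simp add: width_def sum_power2_gt_zero_iff)

lemma pd_x:
  assumes u: "u \<in> I"
  shows "pd 1 x u v = cderiv s u + v *\<^sub>R n u" "pd 2 x u v = e u"
    "pd 1 (pd 1 x) u v = cderiv (cderiv s) u + v *\<^sub>R cderiv n u"
    "pd 2 (pd 1 x) u v = n u" "pd 1 (pd 2 x) u v = n u" "pd 2 (pd 2 x) u v = 0"
proof -
  have x1: "pd 1 x u v = cderiv s u + v *\<^sub>R n u" if "u \<in> I" for u v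
    unfolding surf_def using that by (auto intro!: pd_1_eqI derivative_eq_intros derivs)
  from x1[OF u] show "pd 1 x u v = cderiv s u + v *\<^sub>R n u" .
  have x2: "pd 2 x u v = e u" for u v
    unfolding surf_def by (auto intro!: pd_2_eqI derivative_eq_intros)
  then show "pd 2 x u v = e u" .
  show "pd 1 (pd 1 x) u v = cderiv (cderiv s) u + v *\<^sub>R cderiv n u"
    by (subst pd_cong[OF open_I u x1])
      (use u in \<open>auto intro!: pd_1_eqI derivative_eq_intros derivs\<close>)
  show "pd 2 (pd 1 x) u v = n u"
    by (subst pd_cong[OF open_I u x1]) (auto intro!: pd_2_eqI derivative_eq_intros)
  show "pd 1 (pd 2 x) u v = n u"
    by (subst pd_cong[OF open_I u x2]) (use u in \<open>auto intro!: pd_1_eqI derivs\<close>)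
  show "pd 2 (pd 2 x) u v = 0"
    by (subst pd_cong[OF open_I u x2]) (auto intro!: pd_2_eqI derivative_eq_intros)
qed

text \<open>If \<open>Q\<close> vanished, \<open>y\<close> would be orthogonal to the surface
  normal, hence tangent, against the independence demanded of a relative normalization.\<close>

lemma Q_nonzero:
  assumes u: "u \<in> I"
  shows "Q u v \<noteq> 0"
proof
  assume Q: "Q u v = 0"
  \<comment> \<open>\<open>f\<close> and \<open>g\<close> are the coefficients of
    \<open>\<delta> u *\<^sub>R y u v\<close> in the tangent frame, found by comparing the
    components along \<open>z\<close> and \<open>e\<close>. The component along \<open>n\<close>
    then agrees exactly because \<open>Q = 0\<close>.\<close>
  define f g where "f = y u v \<bullet> z u" and "g = \<delta> u * (y u v \<bullet> e u) - (cderiv s u \<bullet> e u) * f"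
  have yn: "\<delta> u * (y u v \<bullet> n u) = v * f"
    using Q by (simp add: Q_def m_def f_def inner_simps inner_commute)
  have ex: "a = (a \<bullet> e u) *\<^sub>R e u + (a \<bullet> n u) *\<^sub>R n u + (a \<bullet> z u) *\<^sub>R z u" for a
    using orthonormal_cross_expansion[of "e u" "n u" a] frame[OF u]
    by (simp add: central_tangent_def central_normal_def)
  have s: "cderiv s u = (cderiv s u \<bullet> e u) *\<^sub>R e u + \<delta> u *\<^sub>R z u"
    using ex[of "cderiv s u"] frame[OF u] by simp
  have "\<delta> u *\<^sub>R y u v =
      (\<delta> u * (y u v \<bullet> e u)) *\<^sub>R e u + (\<delta> u * (y u v \<bullet> n u)) *\<^sub>R n u + (\<delta> u * f) *\<^sub>R z u"
    by (subst ex[of "y u v"]) (simp add: f_def scaleR_add_right)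
  also have "\<dots> = f *\<^sub>R (((cderiv s u \<bullet> e u) *\<^sub>R e u + \<delta> u *\<^sub>R z u) + v *\<^sub>R n u) + g *\<^sub>R e u"
    unfolding yn g_def by (simp add: algebra_simps)
  also have "\<dots> = f *\<^sub>R pd 1 x u v + g *\<^sub>R pd 2 x u v"
    using s pd_x[OF u] by simp
  finally have "(- f) *\<^sub>R pd 1 x u v + (- g) *\<^sub>R pd 2 x u v + \<delta> u *\<^sub>R y u v = 0"
    by simp
  then have "\<delta> u = 0"
    using normalization u unfolding relative_normalization_def by blast
  then show False using frame(6)[OF u] by simp
qed

lemma unit_normal_eq: "unit_normal s e u v = m u v /\<^sub>R w u v"
  by (simp add: unit_normal_def m_def central_normal_def)

lemma support_function_eq: "support_function s e y u v = Q u v / w u v"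
  by (simp add: support_function_def unit_normal_eq Q_def field_simps)

text \<open>The factor \<open>1 / w\<close> is common to \<open>h_ij\<close> and to the support
  function and cancels, so no square root is left in the metric.\<close>

lemma relative_metric_eq:
  assumes u: "u \<in> I"
  shows "relative_metric s e y u v $ 1 $ 1 = p u v * (\<delta> u / Q u v)"
    "relative_metric s e y u v $ 1 $ 2 = \<delta> u / Q u v"
    "relative_metric s e y u v $ 2 $ 1 = \<delta> u / Q u v"
    "relative_metric s e y u v $ 2 $ 2 = 0"
  using w_pos[OF u, of v]
  by (simp_all add: relative_metric_def second_ff_def pd_x[OF u] unit_normal_eq
      m_simps[OF u] support_function_eq field_simps)

sublocale null_metric I "relative_metric s e y"
  by unfold_locales (auto simp: open_I relative_metric_eq frame Q_nonzero)

section \<open>Differentiability of the coefficients and of \<open>Q\<close>\<close>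

lemma z_deriv:
  assumes "u \<in> I"
  shows "(z has_vector_derivative cross3 (e u) (cderiv n u)) (at u)"
  using has_vector_derivative_cross3[OF derivs(1,2)[OF assms]]
  by (simp add: central_tangent_def[abs_def] central_normal_def)

text \<open>Third derivatives of the curves enter here: \<open>\<kappa>\<close> contains the second
  derivative of \<open>e\<close>, and the last two functions contain that of
  \<open>s\<close>.\<close>

lemma coefficients_derivs:
  assumes u: "u \<in> I"
  shows "(\<delta> has_real_derivative cderiv \<delta> u) (at u)"
    "(\<kappa> has_real_derivative cderiv \<kappa> u) (at u)"
    "\<exists>D. ((\<lambda>u. n u \<bullet> cderiv (cderiv s) u) has_real_derivative D) (at u)"
    "\<exists>D. ((\<lambda>u. z u \<bullet> cderiv (cderiv s) u) has_real_derivative D) (at u)"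
proof -
  have "\<delta> differentiable (at u)"
    unfolding distribution_parameter_def[abs_def] triple_def
    using has_vector_derivative_inner[OF derivs(5)[OF u]
        has_vector_derivative_cross3[OF derivs(1,2)[OF u]]]
    by (rule differentiableI_vector)
  then show "(\<delta> has_real_derivative cderiv \<delta> u) (at u)"
    by (rule differentiable_has_real_derivative_cderiv)
  have "\<kappa> differentiable (at u)"
    unfolding conical_curvature_def[abs_def] triple_def
    using has_vector_derivative_inner[OF derivs(1)[OF u]
        has_vector_derivative_cross3[OF derivs(2,3)[OF u]]]
    by (rule differentiableI_vector)
  then show "(\<kappa> has_real_derivative cderiv \<kappa> u) (at u)"
    by (rule differentiable_has_real_derivative_cderiv)
  show "\<exists>D. ((\<lambda>u. n u \<bullet> cderiv (cderiv s) u) has_real_derivative D) (at u)"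
    "\<exists>D. ((\<lambda>u. z u \<bullet> cderiv (cderiv s) u) has_real_derivative D) (at u)"
    unfolding has_real_derivative_iff_has_vector_derivative
    using has_vector_derivative_inner[OF derivs(2,6)[OF u]]
      has_vector_derivative_inner[OF z_deriv[OF u] derivs(6)[OF u]] by blast+
qed

lemma Q_deriv_1:
  assumes u: "u \<in> I"
  shows "((\<lambda>t. Q t v) has_real_derivative pd 1 Q u v) (at u)"
proof -
  have "((\<lambda>t. m t v) has_vector_derivative
      (\<delta> u *\<^sub>R cderiv n u + cderiv \<delta> u *\<^sub>R n u) - v *\<^sub>R cross3 (e u) (cderiv n u)) (at u)"
    unfolding m_def
    by (rule derivative_eq_intros derivs(2)[OF u] z_deriv[OF u] coefficients_derivs(1)[OF u] refl)+
      simp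
  from has_vector_derivative_inner[OF this y_derivs(1)[OF u]]
  have "(\<lambda>t. Q t v) differentiable (at u)"
    unfolding Q_def by (rule differentiableI_vector)
  then show ?thesis
    using differentiable_has_real_derivative_cderiv[of "\<lambda>t. Q t v" u]
    by (simp add: pd_1 cderiv_def)
qed

text \<open>\<open>m\<close> is normal to the tangent plane, in which the derivatives of a relative
  normalization lie. Hence the product rule for \<open>Q\<close> effectively differentiates only
  \<open>m\<close>.\<close>

lemma m_pd_y:
  assumes u: "u \<in> I"
  shows "m u v \<bullet> pd i y u v = 0"
proof -
  have "pd i y u v \<in> span {pd 1 x u v, pd 2 x u v}"
    using normalization u unfolding relative_normalization_def by blast
  moreover have "m u v \<bullet> pd 1 x u v = 0" "m u v \<bullet> pd 2 x u v = 0"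
    using u by (simp_all add: pd_x m_simps inner_simps)
  ultimately have "orthogonal (m u v) (pd i y u v)"
    by (elim orthogonal_to_span) (elim insertE emptyE, simp_all add: orthogonal_def)
  then show ?thesis by (simp add: orthogonal_def)
qed

lemma Q_deriv_2:
  assumes u: "u \<in> I"
  shows "(Q u has_real_derivative - (z u \<bullet> y u v)) (at v)"
proof -
  have "(m u has_vector_derivative - z u) (at v)"
    unfolding m_def[abs_def] by (auto intro!: derivative_eq_intros)
  from has_vector_derivative_inner[OF this y_derivs(2)[OF u]] show ?thesis
    by (simp add: Q_def[abs_def] m_pd_y[OF u] has_real_derivative_iff_has_vector_derivative)
qed

text \<open>The mixed derivative of \<open>Q\<close>, taken first in \<open>v\<close> and then in
  \<open>u\<close>. It is written out so that its joint continuity can be read off.\<close>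

definition Q21 :: "real \<Rightarrow> real \<Rightarrow> real" where
  "Q21 u v = - (z u \<bullet> pd 1 y u v + cross3 (e u) (cderiv n u) \<bullet> y u v)"

lemma Q_deriv_21:
  assumes u: "u \<in> I"
  shows "((\<lambda>t. - (z t \<bullet> y t v)) has_real_derivative Q21 u v) (at u)"
  using has_vector_derivative_minus[OF has_vector_derivative_inner[OF z_deriv[OF u] y_derivs(1)[OF u]]]
  by (simp add: Q21_def has_real_derivative_iff_has_vector_derivative)

text \<open>\<open>partials_commute\<close> applies because the \<open>v\<close>-derivative
  \<open>- (z u \<bullet> y u v)\<close> has a continuous \<open>u\<close>-derivative involving only
  first derivatives of \<open>y\<close>.\<close>

lemma Q_deriv_12:
  assumes u: "u \<in> I"
  shows "(pd 1 Q u has_real_derivative Q21 u v) (at v)"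
  unfolding has_real_derivative_iff_has_vector_derivative
proof (rule partials_commute[OF open_I interval_I u])
  have c: "continuous_on I e" "continuous_on I n" "continuous_on I (cderiv n)" "continuous_on I z"
    using derivs z_deriv
    by (auto intro!: continuous_at_imp_continuous_on has_vector_derivative_continuous)
  have y: "C1_on_strip I y" using normalization by (simp add: relative_normalization_def)
  have y0: "continuous_on (I \<times> UNIV) (\<lambda>p. y (fst p) (snd p))"
    using continuous_on_strip_partials[OF open_I y] by (simp add: case_prod_unfold)
  have y1: "continuous_on (I \<times> UNIV) (\<lambda>p. pd 1 y (fst p) (snd p))"
    using y by (simp add: C1_on_strip_def case_prod_unfold)
  show "continuous_on (I \<times> UNIV) (\<lambda>(u, v). Q21 u v)"
    unfolding Q21_def case_prod_unfold
    by (intro continuous_intros continuous_on_cross y0 y1 c[THEN continuous_on_compose2]) auto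
qed (use Q_deriv_1 Q_deriv_2 Q_deriv_21 in
    \<open>auto simp: has_real_derivative_iff_has_vector_derivative\<close>)

text \<open>\<open>\<alpha>\<close> and \<open>\<beta>\<close> are the logarithmic derivatives of \<open>G\<^sub>1\<^sub>2\<close> in \<open>u\<close> and \<open>v\<close>,
  \<open>p2 = p\<^sub>/\<^sub>2\<close>, and \<open>\<gamma> = \<Gamma>\<^sup>2\<^sub>1\<^sub>2\<close>.\<close>

definition \<alpha> :: "real \<Rightarrow> real \<Rightarrow> real" where
  "\<alpha> u v = cderiv \<delta> u / \<delta> u - pd 1 Q u v / Q u v"

definition \<beta> :: "real \<Rightarrow> real \<Rightarrow> real" where
  "\<beta> u v = (z u \<bullet> y u v) / Q u v"

definition p2 :: "real \<Rightarrow> real \<Rightarrow> real" where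
  "p2 u v = - (z u \<bullet> cderiv (cderiv s) u) / \<delta> u - 2 * v * \<kappa> u / \<delta> u"

definition \<gamma> :: "real \<Rightarrow> real \<Rightarrow> real" where
  "\<gamma> u v = (p2 u v + p u v * \<beta> u v) / 2"

text \<open>The shared value in the first two claims is the equality of the mixed derivatives of the
  logarithm of \<open>G_12\<close>; it rests on \<open>Q_deriv_12\<close>.\<close>

lemma \<alpha>_\<beta>_derivs:
  assumes u: "u \<in> I"
  shows "(\<alpha> u has_real_derivative pd 1 \<beta> u v) (at v)"
    "((\<lambda>t. \<beta> t v) has_real_derivative pd 1 \<beta> u v) (at u)"
    "(\<beta> u has_real_derivative pd 2 \<beta> u v) (at v)"
proof -
  note Q0 = Q_nonzero[OF u, of v]
  let ?D = "- Q21 u v / Q u v - (z u \<bullet> y u v) * pd 1 Q u v / (Q u v)\<^sup>2"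
  have \<beta>: "((\<lambda>t. \<beta> t v) has_real_derivative ?D) (at u)"
    using DERIV_divide[OF DERIV_minus[OF Q_deriv_21[OF u, of v]] Q_deriv_1[OF u, of v] Q0] Q0
    by (simp add: \<beta>_def field_simps power2_eq_square)
  then have D: "pd 1 \<beta> u v = ?D" by (rule pd_1_real_eqI)
  show "((\<lambda>t. \<beta> t v) has_real_derivative pd 1 \<beta> u v) (at u)"
    using \<beta> D by simp
  show "(\<alpha> u has_real_derivative pd 1 \<beta> u v) (at v)"
    unfolding D \<alpha>_def[abs_def]
    using DERIV_diff[OF DERIV_const DERIV_divide[OF Q_deriv_12[OF u] Q_deriv_2[OF u] Q0]]
    by (rule DERIV_cong) (use Q0 in \<open>simp add: field_simps power2_eq_square\<close>)
  have "((\<lambda>v. z u \<bullet> y u v) has_real_derivative z u \<bullet> pd 2 y u v) (at v)"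
    using has_vector_derivative_inner[OF has_vector_derivative_const y_derivs(2)[OF u]]
    by (simp add: has_real_derivative_iff_has_vector_derivative)
  from DERIV_divide[OF this Q_deriv_2[OF u] Q0]
  have "(\<beta> u has_real_derivative ((z u \<bullet> pd 2 y u v) * Q u v - (z u \<bullet> y u v) * - (z u \<bullet> y u v))
      / (Q u v * Q u v)) (at v)" (is "(_ has_real_derivative ?D2) _")
    by (simp add: \<beta>_def[abs_def])
  moreover from this have "pd 2 \<beta> u v = ?D2" by (rule pd_2_real_eqI)
  ultimately show "(\<beta> u has_real_derivative pd 2 \<beta> u v) (at v)" by simp
qed

lemma p_derivs:
  assumes u: "u \<in> I"
  shows "(p u has_real_derivative p2 u v) (at v)"
    "(p2 u has_real_derivative - 2 * \<kappa> u / \<delta> u) (at v)"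
    "\<exists>D. ((\<lambda>t. p t v) has_real_derivative D) (at u)"
    "\<exists>D. ((\<lambda>t. p2 t v) has_real_derivative D) (at u)"
proof -
  show "(p u has_real_derivative p2 u v) (at v)"
    "(p2 u has_real_derivative - 2 * \<kappa> u / \<delta> u) (at v)"
    unfolding p_def[abs_def] p2_def[abs_def] using frame(6)[OF u]
    by (auto intro!: derivative_eq_intros)
  obtain D1 D2 where D: "((\<lambda>u. n u \<bullet> cderiv (cderiv s) u) has_real_derivative D1) (at u)"
    "((\<lambda>u. z u \<bullet> cderiv (cderiv s) u) has_real_derivative D2) (at u)"
    using coefficients_derivs(3,4)[OF u] by blast
  show "\<exists>D. ((\<lambda>t. p t v) has_real_derivative D) (at u)"
    unfolding p_def
    by (rule exI, rule DERIV_diff[OF DERIV_diff[OF D(1)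
          DERIV_divide[OF DERIV_cmult[OF D(2)] coefficients_derivs(1)[OF u] frame(6)[OF u]]]
        DERIV_divide[OF DERIV_cmult[OF coefficients_derivs(2)[OF u]]
          coefficients_derivs(1)[OF u] frame(6)[OF u]]])
  show "\<exists>D. ((\<lambda>t. p2 t v) has_real_derivative D) (at u)"
    unfolding p2_def
    by (rule exI, rule DERIV_diff[OF
          DERIV_divide[OF DERIV_minus[OF D(2)] coefficients_derivs(1)[OF u] frame(6)[OF u]]
          DERIV_divide[OF DERIV_cmult[OF coefficients_derivs(2)[OF u]]
            coefficients_derivs(1)[OF u] frame(6)[OF u]]])
qed

text \<open>The \<open>u\<close>-derivative may stay implicit, since it enters the Darboux tensor
  only as a coefficient of \<open>e u\<close>, which is orthogonal to \<open>m\<close>. The explicit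
  \<open>v\<close>-derivative feeds the curvature.\<close>

lemma \<gamma>_derivs:
  assumes u: "u \<in> I"
  shows "((\<lambda>t. \<gamma> t v) has_real_derivative pd 1 \<gamma> u v) (at u)"
    "(\<gamma> u has_real_derivative (- 2 * \<kappa> u / \<delta> u + (p u v * pd 2 \<beta> u v + p2 u v * \<beta> u v)) / 2) (at v)"
proof -
  obtain D1 D2 where D: "((\<lambda>t. p t v) has_real_derivative D1) (at u)"
    "((\<lambda>t. p2 t v) has_real_derivative D2) (at u)"
    using p_derivs(3,4)[OF u] by blast
  have "((\<lambda>t. \<gamma> t v) has_real_derivative (D2 + (p u v * pd 1 \<beta> u v + D1 * \<beta> u v)) / 2) (at u)"
    unfolding \<gamma>_def
    by (intro DERIV_cdivide DERIV_add DERIV_mult' D \<alpha>_\<beta>_derivs(2)[OF u])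
  moreover from this have "pd 1 \<gamma> u v = (D2 + (p u v * pd 1 \<beta> u v + D1 * \<beta> u v)) / 2"
    by (rule pd_1_real_eqI)
  ultimately show "((\<lambda>t. \<gamma> t v) has_real_derivative pd 1 \<gamma> u v) (at u)" by (simp only:)
  show "(\<gamma> u has_real_derivative (- 2 * \<kappa> u / \<delta> u + (p u v * pd 2 \<beta> u v + p2 u v * \<beta> u v)) / 2) (at v)"
    unfolding \<gamma>_def[abs_def]
    by (intro DERIV_cdivide DERIV_add DERIV_mult' p_derivs(1,2) \<alpha>_\<beta>_derivs(3) u)
qed

lemma \<delta>_div_Q_derivs:
  assumes u: "u \<in> I"
  shows "((\<lambda>t. \<delta> t / Q t v) has_real_derivative \<alpha> u v * (\<delta> u / Q u v)) (at u)"
    "((\<lambda>t. \<delta> u / Q u t) has_real_derivative \<beta> u v * (\<delta> u / Q u v)) (at v)"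
proof -
  note Q0 = Q_nonzero[OF u, of v] and d0 = frame(6)[OF u]
  show "((\<lambda>t. \<delta> t / Q t v) has_real_derivative \<alpha> u v * (\<delta> u / Q u v)) (at u)"
    using DERIV_divide[OF coefficients_derivs(1)[OF u] Q_deriv_1[OF u] Q0]
    by (rule DERIV_cong) (use Q0 d0 in \<open>simp add: \<alpha>_def field_simps\<close>)
  show "((\<lambda>t. \<delta> u / Q u t) has_real_derivative \<beta> u v * (\<delta> u / Q u v)) (at v)"
    using DERIV_divide[OF DERIV_const Q_deriv_2[OF u] Q0]
    by (rule DERIV_cong) (use Q0 in \<open>simp add: \<beta>_def field_simps\<close>)
qed

lemma pd_metric:
  assumes u: "u \<in> I"
  shows "pd 1 b u v = \<alpha> u v * b u v" "pd 2 b u v = \<beta> u v * b u v"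
    "pd 2 a u v = 2 * \<gamma> u v * b u v"
proof -
  note b1 = \<delta>_div_Q_derivs(1)[OF u, of v] and b2 = \<delta>_div_Q_derivs(2)[OF u, of v]
  have a2: "((\<lambda>t. p u t * (\<delta> u / Q u t)) has_real_derivative 2 * \<gamma> u v * (\<delta> u / Q u v)) (at v)"
    using DERIV_mult'[OF p_derivs(1)[OF u, of v] b2]
    by (rule DERIV_cong) (simp add: \<gamma>_def algebra_simps)
  have "pd i b u v = pd i (\<lambda>u v. \<delta> u / Q u v) u v"
    "pd i a u v = pd i (\<lambda>u v. p u v * (\<delta> u / Q u v)) u v" for i
    by (rule pd_cong[OF open_I u], simp add: relative_metric_eq)+
  then show "pd 1 b u v = \<alpha> u v * b u v" "pd 2 b u v = \<beta> u v * b u v"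
    "pd 2 a u v = 2 * \<gamma> u v * b u v"
    by (simp_all only: relative_metric_eq[OF u])
      (rule pd_1_real_eqI b1 pd_2_real_eqI b2 a2; rule b1 b2 a2)+
qed

section \<open>Christoffel symbols and the Darboux tensor\<close>

abbreviation \<Gamma> :: "2 \<Rightarrow> 2 \<Rightarrow> 2 \<Rightarrow> real \<Rightarrow> real \<Rightarrow> real" where
  "\<Gamma> \<equiv> christoffel (relative_metric s e y)"

lemma christoffel_eq:
  assumes u: "u \<in> I"
  shows "\<Gamma> 1 1 1 u v = \<alpha> u v - \<gamma> u v"
    "\<Gamma> 1 1 2 u v = 0" "\<Gamma> 1 2 1 u v = 0" "\<Gamma> 1 2 2 u v = 0"
    "\<Gamma> 2 1 2 u v = \<gamma> u v" "\<Gamma> 2 2 1 u v = \<gamma> u v" "\<Gamma> 2 2 2 u v = \<beta> u v"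
  using G12[OF u, of v] by (simp_all add: christoffel_G[OF u] pd_metric[OF u] diff_divide_distrib)

text \<open>The indices are ordered so that \<open>W\<close> is the very field to which
  \<open>darboux\<close> applies \<open>nabla2\<close>.\<close>

abbreviation W :: "2 \<Rightarrow> 2 \<Rightarrow> real \<Rightarrow> real \<Rightarrow> real^3" where
  "W i j \<equiv> nabla1 (relative_metric s e y) (\<lambda>i. pd i x) j i"

lemma W_eq:
  assumes u: "u \<in> I"
  shows "W 1 2 u v = n u - \<gamma> u v *\<^sub>R e u" "W 2 1 u v = n u - \<gamma> u v *\<^sub>R e u"
    "W 2 2 u v = - \<beta> u v *\<^sub>R e u"
  by (simp_all add: nabla1_def sum_2 christoffel_eq[OF u] pd_x[OF u])

text \<open>\<open>n\<close> and \<open>e\<close> do not depend on \<open>v\<close>, so the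
  \<open>v\<close>-derivatives are multiples of \<open>e u\<close>. Their coefficients may remain
  unspecified, as \<open>m\<close> is orthogonal to \<open>e\<close>.\<close>

lemma pd_W:
  assumes u: "u \<in> I"
  shows "pd 1 (W 1 2) u v = cderiv n u - (\<gamma> u v *\<^sub>R n u + pd 1 \<gamma> u v *\<^sub>R e u)"
    "pd 1 (W 2 1) u v = cderiv n u - (\<gamma> u v *\<^sub>R n u + pd 1 \<gamma> u v *\<^sub>R e u)"
    "pd 1 (W 2 2) u v = - (\<beta> u v *\<^sub>R n u + pd 1 \<beta> u v *\<^sub>R e u)"
    "\<exists>c. pd 2 (W 1 2) u v = c *\<^sub>R e u" "\<exists>c. pd 2 (W 2 1) u v = c *\<^sub>R e u"
    "\<exists>c. pd 2 (W 2 2) u v = c *\<^sub>R e u"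
proof -
  have eq: "pd i (W 1 2) u v = pd i (\<lambda>u v. n u - \<gamma> u v *\<^sub>R e u) u v"
    "pd i (W 2 1) u v = pd i (\<lambda>u v. n u - \<gamma> u v *\<^sub>R e u) u v"
    "pd i (W 2 2) u v = pd i (\<lambda>u v. - (\<beta> u v *\<^sub>R e u)) u v" for i
    by (rule pd_cong[OF open_I u], simp add: W_eq)+
  show "pd 1 (W 1 2) u v = cderiv n u - (\<gamma> u v *\<^sub>R n u + pd 1 \<gamma> u v *\<^sub>R e u)"
    "pd 1 (W 2 1) u v = cderiv n u - (\<gamma> u v *\<^sub>R n u + pd 1 \<gamma> u v *\<^sub>R e u)"
    "pd 1 (W 2 2) u v = - (\<beta> u v *\<^sub>R n u + pd 1 \<beta> u v *\<^sub>R e u)"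
    unfolding eq
    by (intro pd_1_eqI has_vector_derivative_minus has_vector_derivative_diff
        has_vector_derivative_scaleR derivs \<gamma>_derivs \<alpha>_\<beta>_derivs u)+
  have "((\<lambda>v. n u - \<gamma> u v *\<^sub>R e u) has_vector_derivative (- D) *\<^sub>R e u) (at v)"
    if "(\<gamma> u has_real_derivative D) (at v)" for D
    using has_vector_derivative_diff[OF has_vector_derivative_const
        has_vector_derivative_scaleR[OF that has_vector_derivative_const]] by simp
  then have "pd 2 (\<lambda>u v. n u - \<gamma> u v *\<^sub>R e u) u v = (- D) *\<^sub>R e u"
    if "(\<gamma> u has_real_derivative D) (at v)" for D
    using that by (intro pd_2_eqI) blast
  from this[OF \<gamma>_derivs(2)[OF u]]
  show "\<exists>c. pd 2 (W 1 2) u v = c *\<^sub>R e u" "\<exists>c. pd 2 (W 2 1) u v = c *\<^sub>R e u"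
    unfolding eq by blast+
  have "((\<lambda>v. - (\<beta> u v *\<^sub>R e u)) has_vector_derivative (- pd 2 \<beta> u v) *\<^sub>R e u) (at v)"
    using has_vector_derivative_minus[OF
        has_vector_derivative_scaleR[OF \<alpha>_\<beta>_derivs(3)[OF u] has_vector_derivative_const]] by simp
  then show "\<exists>c. pd 2 (W 2 2) u v = c *\<^sub>R e u"
    unfolding eq by (intro exI, intro pd_2_eqI)
qed

abbreviation A :: "2 \<Rightarrow> 2 \<Rightarrow> 2 \<Rightarrow> real \<Rightarrow> real \<Rightarrow> real" where
  "A \<equiv> darboux s e y"

lemma darboux_m:
  assumes u: "u \<in> I"
  shows "A i j k u v = (m u v \<bullet> nabla2 (relative_metric s e y) W k i j u v) / Q u v"
  using w_pos[OF u, of v] by (simp add: darboux_def unit_normal_eq support_function_eq)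

text \<open>In these components \<open>W 1 1\<close> occurs only with coefficients
  \<open>\<Gamma>^1_12\<close>, \<open>\<Gamma>^1_21\<close> or \<open>\<Gamma>^1_22\<close>, all
  zero, and \<open>\<Gamma>^2_11\<close> only with \<open>W 2 2\<close>, a multiple of
  \<open>e\<close> and so orthogonal to \<open>m\<close>.\<close>

lemma darboux_eq:
  assumes u: "u \<in> I"
  shows "A 1 2 1 u v = - (v * \<kappa> u / \<delta> u + \<alpha> u v + \<gamma> u v) * b u v"
    "A 2 1 1 u v = - (v * \<kappa> u / \<delta> u + \<alpha> u v + \<gamma> u v) * b u v"
    "A 1 2 2 u v = - \<beta> u v * b u v" "A 2 1 2 u v = - \<beta> u v * b u v"
    "A 2 2 1 u v = - \<beta> u v * b u v" "A 2 2 2 u v = 0"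
proof -
  obtain c1 c2 c3 where c: "pd 2 (W 1 2) u v = c1 *\<^sub>R e u" "pd 2 (W 2 1) u v = c2 *\<^sub>R e u"
    "pd 2 (W 2 2) u v = c3 *\<^sub>R e u"
    using pd_W(4-6)[OF u] by blast
  show "A 1 2 1 u v = - (v * \<kappa> u / \<delta> u + \<alpha> u v + \<gamma> u v) * b u v"
    "A 2 1 1 u v = - (v * \<kappa> u / \<delta> u + \<alpha> u v + \<gamma> u v) * b u v"
    "A 1 2 2 u v = - \<beta> u v * b u v" "A 2 1 2 u v = - \<beta> u v * b u v"
    "A 2 2 1 u v = - \<beta> u v * b u v" "A 2 2 2 u v = 0"
    unfolding darboux_m[OF u] nabla2_def sum_2 christoffel_eq[OF u] W_eq[OF u] pd_W(1-3)[OF u]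
      c inner_diff_right inner_add_right inner_minus_right inner_scaleR_right m_simps[OF u]
      relative_metric_eq[OF u]
    using Q_nonzero[OF u, of v] frame(6)[OF u] by (simp_all add: m_simps[OF u] field_simps)
qed

section \<open>Tchebychev vector, divergence and curvature\<close>

lemma tchebychev_eq:
  assumes u: "u \<in> I"
  shows "tchebychev s e y 1 u v = - \<beta> u v / b u v"
    "tchebychev s e y 2 u v = (- v * (\<kappa> u / \<delta> u) - \<alpha> u v - p2 u v / 2 + p u v * \<beta> u v) / b u v"
proof -
  have "a u v = p u v * b u v" by (simp add: relative_metric_eq[OF u])
  \<comment> \<open>\<open>G^(11) = 0\<close> removes \<open>A 1 1 1\<close> and
    \<open>A 1 1 2\<close>, so \<open>darboux_eq\<close> covers all remaining terms. In the second
    component the terms with \<open>G^(22)\<close> give \<open>3/2\<close> of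
    \<open>p \<beta>\<close>, and \<open>- \<gamma>\<close> takes away one half.\<close>
  then show "tchebychev s e y 1 u v = - \<beta> u v / b u v"
    "tchebychev s e y 2 u v = (- v * (\<kappa> u / \<delta> u) - \<alpha> u v - p2 u v / 2 + p u v * \<beta> u v) / b u v"
    using G12[OF u, of v] frame(6)[OF u]
    by (simp_all add: tchebychev_def sum_2 ginv_G[OF u] darboux_eq[OF u] \<gamma>_def field_simps
        power2_eq_square)
qed

lemma divergence_eq:
  assumes u: "u \<in> I"
  shows "divergence (relative_metric s e y) (tchebychev s e y) u v =
    (p u v * pd 2 \<beta> u v + p2 u v * \<beta> u v - 2 * pd 1 \<beta> u v) / b u v"
proof -
  let ?g = "\<lambda>u v. \<delta> u / Q u v"
  let ?f = "\<lambda>u v. - v * (\<kappa> u / \<delta> u) - \<alpha> u v - p2 u v / 2 + p u v * \<beta> u v"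
  have g0: "?g u v \<noteq> 0" using Q_nonzero frame(6) u by simp
  \<comment> \<open>The density cancels the denominator of the components up to the sign of
    \<open>G_12\<close>. At \<open>t = 0\<close> both sides are \<open>0\<close>, so the rewriting
    has no side condition.\<close>
  have *: "\<bar>t\<bar> * (c / t) = sgn t * c" for c t :: real
    by (simp add: sgn_if)
  have "pd 1 (\<lambda>u v. sqrt \<bar>det (relative_metric s e y u v)\<bar> * tchebychev s e y 1 u v) u v =
      pd 1 (\<lambda>u v. sgn (?g u v) * - \<beta> u v) u v"
    by (rule pd_cong[OF open_I u], simp only: sqrt_det_G tchebychev_eq relative_metric_eq *)
  also have "\<dots> = sgn (?g u v) * - pd 1 \<beta> u v"
    by (intro pd_1_real_eqI has_real_derivative_sgn_mult DERIV_minus \<alpha>_\<beta>_derivs u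
        DERIV_isCont[OF \<delta>_div_Q_derivs(1)] g0)
  finally have 1: "pd 1 (\<lambda>u v. sqrt \<bar>det (relative_metric s e y u v)\<bar> * tchebychev s e y 1 u v) u v
      = sgn (?g u v) * - pd 1 \<beta> u v" .
  \<comment> \<open>The terms in \<open>\<kappa> / \<delta>\<close> cancel: the first summand of
    \<open>?f\<close> contributes one with a minus sign, and \<open>- p2 / 2\<close> contributes one
    with a plus sign.\<close>
  have f: "(?f u has_real_derivative
      - 1 * (\<kappa> u / \<delta> u) - pd 1 \<beta> u v - (- 2 * \<kappa> u / \<delta> u) / 2
        + (p u v * pd 2 \<beta> u v + p2 u v * \<beta> u v)) (at v)"
    by (intro DERIV_add DERIV_diff DERIV_mult' DERIV_cdivide DERIV_cmult_right DERIV_minus DERIV_ident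
        p_derivs(1,2) \<alpha>_\<beta>_derivs u)
  have "pd 2 (\<lambda>u v. sqrt \<bar>det (relative_metric s e y u v)\<bar> * tchebychev s e y 2 u v) u v =
      pd 2 (\<lambda>u v. sgn (?g u v) * ?f u v) u v"
    by (rule pd_cong[OF open_I u], simp only: sqrt_det_G tchebychev_eq relative_metric_eq *)
  also have "\<dots> = sgn (?g u v) * (p u v * pd 2 \<beta> u v + p2 u v * \<beta> u v - pd 1 \<beta> u v)"
  proof (rule pd_2_real_eqI)
    have "isCont (?g u) v"
      by (rule DERIV_isCont[OF \<delta>_div_Q_derivs(2)[OF u]])
    from has_real_derivative_sgn_mult[OF this g0 f]
    show "((\<lambda>v. sgn (?g u v) * ?f u v) has_real_derivative
        sgn (?g u v) * (p u v * pd 2 \<beta> u v + p2 u v * \<beta> u v - pd 1 \<beta> u v)) (at v)"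
      by (rule DERIV_cong) simp
  qed
  finally have 2: "pd 2 (\<lambda>u v. sqrt \<bar>det (relative_metric s e y u v)\<bar> * tchebychev s e y 2 u v) u v
      = sgn (?g u v) * (p u v * pd 2 \<beta> u v + p2 u v * \<beta> u v - pd 1 \<beta> u v)" .
  have sgn_div: "sgn t * c / \<bar>t\<bar> = c / t" for t c :: real by (simp add: sgn_if)
  show ?thesis
    unfolding divergence_def sum_2 1 2 sqrt_det_G[OF u] relative_metric_eq[OF u]
      distrib_left[symmetric] sgn_div
    by (rule arg_cong[where f = "\<lambda>c. c / _"]) simp
qed

lemma scalar_curvature_eq:
  assumes u: "u \<in> I"
  shows "2 * scalar_curvature (relative_metric s e y) u v =
    (p u v * pd 2 \<beta> u v + p2 u v * \<beta> u v - 2 * \<kappa> u / \<delta> u - 2 * pd 1 \<beta> u v) / b u v"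
proof -
  \<comment> \<open>The two quotients in \<open>scalar_curvature_G\<close> are the Christoffel
    symbols \<open>\<gamma>\<close> and \<open>\<beta>\<close>.\<close>
  have "pd 2 (\<lambda>u v. pd 2 a u v / (2 * b u v)) u v = pd 2 \<gamma> u v"
    "pd 1 (\<lambda>u v. pd 2 b u v / b u v) u v = pd 1 \<beta> u v"
    by (rule pd_cong[OF open_I u], simp add: pd_metric)+
  then show ?thesis
    unfolding scalar_curvature_G[OF u] pd_2_real_eqI[of \<gamma>, OF \<gamma>_derivs(2)[OF u]]
    by (simp add: field_simps)
qed

lemma divergence_minus_curvature:
  assumes u: "u \<in> I"
  shows "divergence (relative_metric s e y) (tchebychev s e y) u v
      - 2 * scalar_curvature (relative_metric s e y) u v
    = 2 * \<kappa> u * w u v * support_function s e y u v / (\<delta> u)\<^sup>2"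
proof -
  \<comment> \<open>The two numerators differ exactly by \<open>2 * \<kappa> u / \<delta> u\<close>,
    which the divergence lacks. Inserting \<open>b = \<delta> / Q\<close> and \<open>Q = w q\<close>
    then gives the claim.\<close>
  have "divergence (relative_metric s e y) (tchebychev s e y) u v
      - 2 * scalar_curvature (relative_metric s e y) u v = (2 * \<kappa> u / \<delta> u) / b u v"
    unfolding divergence_eq[OF u] scalar_curvature_eq[OF u] diff_divide_distrib[symmetric] by simp
  then show ?thesis
    using w_pos[OF u, of v]
    by (simp add: relative_metric_eq[OF u] support_function_eq power2_eq_square)
qed

end

theorem mainTheorem6:
  fixes r :: nat and I :: "real set"
    and s e :: "real \<Rightarrow> real^3" and y :: "real \<Rightarrow> real \<Rightarrow> real^3" and u v :: real
  assumes "skew_ruled_surface r I s e"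
    and "relative_normalization I s e y"
    and "u \<in> I"
  shows "divergence (relative_metric s e y) (tchebychev s e y) u v
           - 2 * scalar_curvature (relative_metric s e y) u v
         = 2 * conical_curvature e u * width s e u v * support_function s e y u v
             / (distribution_parameter s e u)\<^sup>2"
proof -
  interpret relatively_normalized_ruled_surface r I s e y
    using assms(1,2) by unfold_locales
  show ?thesis by (rule divergence_minus_curvature[OF assms(3)])
qed

end
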